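(* Let $p\in(0,\infty]$, $q\in(0,\infty]$ and let $b$ be a slowly varying function. If the space $L^{p,q,b}$ is non-trivial (i.e. contains a non-zero function), then its lower and upper Boyd indices satisfy $$\underline{\alpha}_{L^{p,q,b}}=\overline{\alpha}_{L^{p,q,b}}=\frac1p .$$ If the space $L^{(p,q,b)}$ is non-trivial, then its lower and upper Boyd indices satisfy $$\underline{\alpha}_{L^{(p,q,b)}}=\overline{\alpha}_{L^{(p,q,b)}}=\frac1p .$$
   Context: $(R,\mu)$ is a $\sigma$-finite non-atomic measure space with $\mu(R)=\infty$; $M(R,\mu)$ is the set of extended complex-valued $\mu$-measurable functions on $R$. For measurable $f$, $f^*(t)=\inf\{s\ge 0:\mu(\{|f|>s\})\le t\}$ and $f^{**}(t)=\frac1t\int_0^t f^*(s)\,ds$. Convention: $1/\infty=0$. A measurable $b:(0,\infty)\to(0,\infty)$ is slowly varying if for every $\varepsilon>0$ there are a non-decreasing function $b_\varepsilon$ and a non-increasing function $b_{-\varepsilon}$ with $t^\varepsilon b(t)\approx b_\varepsilon(t)$ and $t^{-\varepsilon}b(t)\approx b_{-\varepsilon}(t)$ on $(0,\infty)$, where $\approx$ denotes two-sided estimate up to positive finite multiplicative constants. For $f\in M(R,\mu)$, $\lVert f\rVert_{p,q,b}=\lVert t^{1/p-1/q}b(t)f^*(t)\rVert_q$ and $\lVert f\rVert_{(p,q,b)}=\lVert t^{1/p-1/q}b(t)f^{**}(t)\rVert_q$, where $\lVert\cdot\rVert_q$ is the Lebesgue $L^q$ (quasi)norm over $(0,\infty)$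 in the variable $t$; $L^{p,q,b}$ and $L^{(p,q,b)}$ are the sets of functions for which the respective functional is finite. Boyd indices: for $X$ one of these spaces, let $\bar X$ be its representation space, i.e. the space over $([0,\infty),\lambda)$ ($\lambda$ Lebesgue measure) defined by the same formula. For $t\in(0,\infty)$ let $D_tf(s)=f(ts)$, $s\in[0,\infty)$, for measurable $f$ on $[0,\infty)$; these operators are bounded on $\bar X$ when $X$ is non-trivial. Let $h_X(t)$ be the operator norm of $D_{t^{-1}}:\bar X\to\bar X$, i.e. the supremum of $\lVert D_{t^{-1}}f\rVert_{\bar X}$ over $\lVert f\rVert_{\bar X}\le1$. Then $$\underline{\alpha}_X=\sup_{t\in(0,1)}\frac{\log h_X(t)}{\log t},\qquad \overline{\alpha}_X=\inf_{t\in(1,\infty)}\frac{\log h_X(t)}{\log t}.$$ *)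

theory Defs
  imports "HOL-Analysis.Analysis" "HOL-Probability.Essential_Supremum"
begin

definition atom :: "'a measure \<Rightarrow> 'a set \<Rightarrow> bool" where
  "atom M A \<longleftrightarrow> A \<in> sets M \<and> emeasure M A > 0 \<and>
     (\<forall>B \<in> sets M. B \<subseteq> A \<longrightarrow> emeasure M B = 0 \<or> emeasure M (A - B) = 0)"

definition non_atomic :: "'a measure \<Rightarrow> bool" where
  "non_atomic M \<longleftrightarrow> (\<nexists>A. atom M A)"

text \<open>
  Extended complex numbers are rendered as the one-point compactification of the complex plane:
  \<^term>\<open>None\<close> is the point at infinity, and measurability refers to the Borel sets of
  that compactification.
\<close>

type_synonym ecomplex = "complex option"

definition ecomplex_borel :: "ecomplex measure" where
  "ecomplex_borel = sigma UNIV {U. openin (Alexandroff_compactification euclidean) U}"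

definition emod :: "ecomplex \<Rightarrow> ennreal" where
  "emod z = (case z of None \<Rightarrow> \<infinity> | Some w \<Rightarrow> ennreal (cmod w))"

definition measurable_functions :: "'a measure \<Rightarrow> ('a \<Rightarrow> ecomplex) set" where
  "measurable_functions M = measurable M ecomplex_borel"

definition rearr :: "'a measure \<Rightarrow> ('a \<Rightarrow> ecomplex) \<Rightarrow> real \<Rightarrow> ennreal" where
  "rearr M f t = (INF s \<in> {s. 0 \<le> s \<and> emeasure M {x \<in> space M. emod (f x) > ennreal s} \<le> ennreal t}. ennreal s)"

definition max_rearr :: "'a measure \<Rightarrow> ('a \<Rightarrow> ecomplex) \<Rightarrow> real \<Rightarrow> ennreal" where
  "max_rearr M f t = ennreal (1 / t) * (\<integral>\<^sup>+ s \<in> {0<..<t}. rearr M f s \<partial>lebesgue)"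

definition approx_on :: "real set \<Rightarrow> (real \<Rightarrow> real) \<Rightarrow> (real \<Rightarrow> real) \<Rightarrow> bool" where
  "approx_on S g h \<longleftrightarrow> (\<exists>c>0. \<exists>C>0. \<forall>t\<in>S. c * h t \<le> g t \<and> g t \<le> C * h t)"

definition slowly_varying :: "(real \<Rightarrow> real) \<Rightarrow> bool" where
  "slowly_varying b \<longleftrightarrow>
     b \<in> borel_measurable (lebesgue_on {0<..}) \<and> (\<forall>t>0. b t > 0) \<and>
     (\<forall>\<epsilon>>0. (\<exists>g. mono_on {0<..} g \<and> approx_on {0<..} (\<lambda>t. t powr \<epsilon> * b t) g) \<and>
            (\<exists>h. antimono_on {0<..} h \<and> approx_on {0<..} (\<lambda>t. t powr (- \<epsilon>) * b t) h))"

text \<open>Only used with exponents \<open>r > 0\<close>.\<close>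

definition epowr :: "ennreal \<Rightarrow> real \<Rightarrow> ennreal" where
  "epowr x r = (if x = \<infinity> then \<infinity> else ennreal (enn2real x powr r))"

definition Lq_norm :: "ereal \<Rightarrow> (real \<Rightarrow> ennreal) \<Rightarrow> ennreal" where
  "Lq_norm q g =
     (if q = \<infinity> then esssup (lebesgue_on {0<..}) g
      else epowr (\<integral>\<^sup>+ t. epowr (g t) (real_of_ereal q) \<partial>lebesgue_on {0<..}) (1 / real_of_ereal q))"

text \<open>
  For extended reals \<open>1 / \<infinity> = 0\<close>, so for positive \<open>p\<close> and \<open>q\<close> the exponent
  \<open>1 / p - 1 / q\<close> is finite.
\<close>

definition LK_norm :: "'a measure \<Rightarrow> ereal \<Rightarrow> ereal \<Rightarrow> (real \<Rightarrow> real) \<Rightarrow> ('a \<Rightarrow> ecomplex) \<Rightarrow> ennreal" where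
  "LK_norm M p q b f =
     Lq_norm q (\<lambda>t. ennreal (t powr real_of_ereal (1 / p - 1 / q) * b t) * rearr M f t)"

definition LK_max_norm :: "'a measure \<Rightarrow> ereal \<Rightarrow> ereal \<Rightarrow> (real \<Rightarrow> real) \<Rightarrow> ('a \<Rightarrow> ecomplex) \<Rightarrow> ennreal" where
  "LK_max_norm M p q b f =
     Lq_norm q (\<lambda>t. ennreal (t powr real_of_ereal (1 / p - 1 / q) * b t) * max_rearr M f t)"

definition LK_space :: "'a measure \<Rightarrow> ereal \<Rightarrow> ereal \<Rightarrow> (real \<Rightarrow> real) \<Rightarrow> ('a \<Rightarrow> ecomplex) set" where
  "LK_space M p q b = {f \<in> measurable_functions M. LK_norm M p q b f < \<infinity>}"

definition LK_max_space :: "'a measure \<Rightarrow> ereal \<Rightarrow> ereal \<Rightarrow> (real \<Rightarrow> real) \<Rightarrow> ('a \<Rightarrow> ecomplex) set" where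
  "LK_max_space M p q b = {f \<in> measurable_functions M. LK_max_norm M p q b f < \<infinity>}"

text \<open>As usual, functions that agree almost everywhere are identified.\<close>

definition nontrivial_space :: "'a measure \<Rightarrow> ('a \<Rightarrow> ecomplex) set \<Rightarrow> bool" where
  "nontrivial_space M X \<longleftrightarrow> (\<exists>f\<in>X. \<not> (AE x in M. f x = Some 0))"

abbreviation half_line :: "real measure" where
  "half_line \<equiv> lebesgue_on {0..}"

definition dilate :: "real \<Rightarrow> (real \<Rightarrow> ecomplex) \<Rightarrow> real \<Rightarrow> ecomplex" where
  "dilate t f = (\<lambda>s. f (t * s))"

text \<open>
  In the following three definitions \<open>N\<close> is the functional of the representation space,
  so that this space consists of the measurable \<open>f\<close> on the half-line with
  \<open>N f < \<infinity>\<close>.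
\<close>

definition dilation_norm :: "((real \<Rightarrow> ecomplex) \<Rightarrow> ennreal) \<Rightarrow> real \<Rightarrow> ennreal" where
  "dilation_norm N t = (SUP f \<in> {f \<in> measurable_functions half_line. N f \<le> 1}. N (dilate (1 / t) f))"

definition eln :: "ennreal \<Rightarrow> ereal" where
  "eln x = (if x = 0 then - \<infinity> else if x = \<infinity> then \<infinity> else ereal (ln (enn2real x)))"

definition lower_boyd :: "((real \<Rightarrow> ecomplex) \<Rightarrow> ennreal) \<Rightarrow> ereal" where
  "lower_boyd N = (SUP t \<in> {0<..<1}. eln (dilation_norm N t) / ereal (ln t))"

definition upper_boyd :: "((real \<Rightarrow> ecomplex) \<Rightarrow> ennreal) \<Rightarrow> ereal" where
  "upper_boyd N = (INF t \<in> {1<..}. eln (dilation_norm N t) / ereal (ln t))"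

end

(*
  On the half-line f -> f(s/t) dilates f* and f** to f*(s/t) and f**(s/t), so a change of variables
  moves the dilation onto the weight, and slow variation of b bounds the dilation norm h(t) by
  C t^(1/p) e^(\<epsilon> |ln t|) for every \<epsilon> > 0. For the reverse estimate let \<phi>(a) be the norm of the
  indicator of [0, a), which is finite as soon as the space over M is non-trivial. Then
  \<phi>(t a) \<le> h(t) \<phi>(a), hence \<phi>(t^n) \<le> h(t)^n \<phi>(1), while the upper bound applied to the dilation
  by t^(-n) bounds \<phi>(t^n) from below. Taking n-th roots gives t^(1/p) \<le> h(t) for every t > 0.
*)

theory Submission
  imports Defs
begin

text \<open>The two estimates of h play unequal roles. A constant factor in the upper bound
  disappears from log h(t) / log t as t tends to 0 or infinity. A constant c < 1 in the lower bound
  would stay visible at each fixed t, and the indices are a supremum and an infimum over all t. So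
  h(t) \<ge> t^(1/p) is wanted with constant exactly 1, although slow variation of b only speaks up
  to constants; iterating one fixed dilation removes the constant. Both norms are the same weighted
  L^q functional applied to an operator T acting on f*, where T is the identity or the mean over (0,
  t). What enters about the L^q functional is monotonicity, homogeneity, the scaling law and the
  vanishing of functions of norm 0; all of these hold for every q in (0, infinity], the quasinormed
  range included.\<close>

abbreviation pos_line :: "real measure" where
  "pos_line \<equiv> lebesgue_on {0<..}"

section \<open>The L^q functional on (0, infinity) and its scaling law\<close>

lemma epowr_ennreal: "0 \<le> x \<Longrightarrow> epowr (ennreal x) r = ennreal (x powr r)"
  by (simp add: epowr_def)

lemma epowr_mono:
  assumes "x \<le> y" "0 < r"
  shows "epowr x r \<le> epowr y r"
proof (cases "y = \<infinity>")
  case False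
  then have "x \<noteq> \<infinity>" using assms(1) by (auto simp: top_unique)
  moreover have "enn2real x \<le> enn2real y"
    using assms(1) False by (intro enn2real_mono) (auto simp: top.not_eq_extremum)
  ultimately show ?thesis
    using False assms(2) by (auto simp: epowr_def intro!: ennreal_leI powr_mono2)
qed (simp add: epowr_def)

lemma epowr_mult:
  assumes "0 < r"
  shows "epowr (x * y) r = epowr x r * epowr y r"
proof (cases x; cases y)
  fix a b assume "0 \<le> a" "x = ennreal a" "0 \<le> b" "y = ennreal b"
  then show ?thesis by (simp add: epowr_ennreal powr_mult flip: ennreal_mult)
next
  \<comment> \<open>For a = 0 both sides are 0, because 0 times infinity is 0 and
    \<open>epowr 0 r\<close> is 0; otherwise both are infinite.\<close>
  fix a assume "0 \<le> a" "x = ennreal a" "y = top"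
  then show ?thesis
    by (cases "a = 0") (auto simp: epowr_def ennreal_mult_top ennreal_mult_eq_top_iff)
next
  fix a assume "x = top" "0 \<le> a" "y = ennreal a"
  then show ?thesis
    by (cases "a = 0") (auto simp: epowr_def ennreal_top_mult ennreal_mult_eq_top_iff)
qed (simp add: epowr_def)

lemma epowr_epowr_inverse: "0 < r \<Longrightarrow> epowr (epowr x r) (1 / r) = x"
  by (cases x) (simp_all add: epowr_ennreal powr_powr, simp add: epowr_def)

lemma epowr_eq_0_iff: "0 < r \<Longrightarrow> epowr x r = 0 \<longleftrightarrow> x = 0"
  by (cases x) (simp_all add: epowr_ennreal, simp add: epowr_def)

lemma epowr_measurable [measurable]: "(\<lambda>x. epowr x r) \<in> borel_measurable borel"
  unfolding epowr_def infinity_ennreal_def by measurable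

text \<open>Source and target both carry the completed sigma-algebra, so continuity does not
  suffice: null sets must pull back to measurable sets, which holds because scaling multiplies
  Lebesgue measure by a constant.\<close>

lemma measurable_scale_pos_line [measurable]:
  assumes "0 < t"
  shows "(\<lambda>x. t * x) \<in> pos_line \<rightarrow>\<^sub>M pos_line"
proof (rule measurable_restrict_space3)
  have eq: "(\<lambda>x. t * x) = (*\<^sub>R) t" by auto
  show "(\<lambda>x. t * x) \<in> lebesgue \<rightarrow>\<^sub>M lebesgue"
    unfolding eq by (rule lebesgue_measurable_scaling)
qed (use assms in auto)

lemma nn_integral_pos_line_scale:
  assumes f: "f \<in> borel_measurable pos_line" and t: "0 < t"
  shows "(\<integral>\<^sup>+x. f x \<partial>pos_line) = ennreal t * (\<integral>\<^sup>+x. f (t * x) \<partial>pos_line)"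
proof -
  have m: "(\<lambda>x. f x * indicator {0<..} x) \<in> borel_measurable lebesgue"
    using f by (subst (asm) borel_measurable_restrict_space_iff_ennreal) auto
  have "(\<integral>\<^sup>+x. f x \<partial>pos_line) = (\<integral>\<^sup>+x. f x * indicator {0<..} x \<partial>lebesgue)"
    by (subst nn_integral_restrict_space) auto
  also have "\<dots> = ennreal \<bar>t\<bar> * (\<integral>\<^sup>+x. f (0 + t * x) * indicator {0<..} (0 + t * x) \<partial>lebesgue)"
    using t by (intro nn_integral_real_affine_lebesgue[OF m]) auto
  also have "(\<integral>\<^sup>+x. f (0 + t * x) * indicator {0<..} (0 + t * x) \<partial>lebesgue)
      = (\<integral>\<^sup>+x. f (t * x) * indicator {0<..} x \<partial>lebesgue)"
    using t by (intro nn_integral_cong) (auto simp: indicator_def zero_less_mult_iff)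
  also have "\<dots> = (\<integral>\<^sup>+x. f (t * x) \<partial>pos_line)"
    by (subst nn_integral_restrict_space) auto
  finally show ?thesis using t by simp
qed

text \<open>This serves q = infinity, where the functional contains no integral to substitute in.
  The integral of the indicator of the exceptional set is t times that of the dilated indicator, so
  one vanishes with the other.\<close>

lemma AE_pos_line_scale:
  assumes P: "Measurable.pred pos_line P" and t: "0 < t" and ae: "AE x in pos_line. P (t * x)"
  shows "AE x in pos_line. P x"
proof -
  have "(\<integral>\<^sup>+x. indicator {x. \<not> P x} (t * x) \<partial>pos_line) = (0::ennreal)"
    using ae by (subst nn_integral_cong_AE[where v = "\<lambda>_. 0"]) (auto elim: eventually_mono)
  moreover have m: "(\<lambda>x. indicator {x. \<not> P x} x :: ennreal) \<in> borel_measurable pos_line"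
    using P by measurable
  ultimately have "(\<integral>\<^sup>+x. indicator {x. \<not> P x} x \<partial>pos_line) = (0::ennreal)"
    using t by (simp add: nn_integral_pos_line_scale[OF m t])
  then have "AE x in pos_line. indicator {x. \<not> P x} x = (0::ennreal)"
    by (subst (asm) nn_integral_0_iff_AE[OF m])
  then show ?thesis by eventually_elim (auto simp: indicator_def split: if_splits)
qed

lemma Lq_norm_finite_exponent:
  "0 < r \<Longrightarrow> Lq_norm (ereal r) f = epowr (\<integral>\<^sup>+ t. epowr (f t) r \<partial>pos_line) (1 / r)"
  by (simp add: Lq_norm_def)

lemma pos_ereal_cases:
  assumes "0 < (q::ereal)"
  obtains "q = \<infinity>" | r where "0 < r" "q = ereal r"
  using assms by (cases q) auto

lemma Lq_norm_mono:
  assumes q: "0 < q" and f: "f \<in> borel_measurable pos_line" and le: "\<And>x. 0 < x \<Longrightarrow> f x \<le> g x"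
  shows "Lq_norm q f \<le> Lq_norm q g"
  using q
proof (cases rule: pos_ereal_cases)
  case 1
  then show ?thesis
    by (auto simp: Lq_norm_def le intro!: esssup_AE_mono f AE_I2)
next
  case (2 r)
  then show ?thesis
    by (auto simp: Lq_norm_finite_exponent le intro!: epowr_mono nn_integral_mono)
qed

lemma Lq_norm_cmult:
  assumes q: "0 < q" and f [measurable]: "f \<in> borel_measurable pos_line" and c: "0 < c"
  shows "Lq_norm q (\<lambda>x. ennreal c * f x) = ennreal c * Lq_norm q f"
  using q
proof (cases rule: pos_ereal_cases)
  case 1
  have le: "esssup pos_line (\<lambda>x. ennreal d * g x) \<le> ennreal d * esssup pos_line g"
    if [measurable]: "g \<in> borel_measurable pos_line" for d and g :: "real \<Rightarrow> ennreal"
    using esssup_AE[of g pos_line] by (intro esssup_I) (auto elim!: eventually_mono intro: mult_left_mono)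
  \<comment> \<open>The inequality \<open>le\<close> holds for every constant; the reverse one comes
    from applying it to c f with the constant 1 / c.\<close>
  have "esssup pos_line f = esssup pos_line (\<lambda>x. ennreal (1 / c) * (ennreal c * f x))"
    using c by (simp add: mult.assoc[symmetric] ennreal_mult[symmetric])
  also have "\<dots> \<le> ennreal (1 / c) * esssup pos_line (\<lambda>x. ennreal c * f x)"
    by (rule le) measurable
  finally have "ennreal c * esssup pos_line f
      \<le> ennreal c * (ennreal (1 / c) * esssup pos_line (\<lambda>x. ennreal c * f x))"
    by (rule mult_left_mono) simp
  also have "\<dots> = esssup pos_line (\<lambda>x. ennreal c * f x)"
    using c by (simp add: mult.assoc[symmetric] ennreal_mult[symmetric])
  finally show ?thesis
    using le[OF f, of c] 1 by (simp add: Lq_norm_def)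
next
  case (2 r)
  have "(\<integral>\<^sup>+ t. epowr (ennreal c * f t) r \<partial>pos_line)
      = epowr (ennreal c) r * (\<integral>\<^sup>+ t. epowr (f t) r \<partial>pos_line)"
    using 2 by (simp add: epowr_mult nn_integral_cmult)
  then show ?thesis
    using 2 by (simp add: Lq_norm_finite_exponent epowr_mult epowr_epowr_inverse)
qed

text \<open>The Jacobian t leaves the q-th root as t^(1/q). For q = infinity the factor is t^0 = 1,
  and equality comes from one inequality used for t and for 1 / t.\<close>

lemma Lq_norm_scale:
  assumes q: "0 < q" and f [measurable]: "f \<in> borel_measurable pos_line" and t: "0 < t"
  shows "Lq_norm q f = ennreal (t powr real_of_ereal (1 / q)) * Lq_norm q (\<lambda>x. f (t * x))"
  using q
proof (cases rule: pos_ereal_cases)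
  case 1
  have le: "esssup pos_line g \<le> esssup pos_line (\<lambda>x. g (s * x))"
    if [measurable]: "g \<in> borel_measurable pos_line" and s: "0 < s" for s and g :: "real \<Rightarrow> ennreal"
  proof (rule esssup_I)
    show "AE x in pos_line. g x \<le> esssup pos_line (\<lambda>x. g (s * x))"
      by (rule AE_pos_line_scale[OF _ s esssup_AE]) measurable
  qed measurable
  have "(\<lambda>x. f (t * x)) \<in> borel_measurable pos_line"
    using t by measurable
  from le[OF this, of "1 / t"] have "esssup pos_line (\<lambda>x. f (t * x)) \<le> esssup pos_line f"
    using t by simp
  with le[OF f t] show ?thesis using 1 t by (simp add: Lq_norm_def)
next
  case (2 r)
  have "(\<integral>\<^sup>+ x. epowr (f x) r \<partial>pos_line) = ennreal t * (\<integral>\<^sup>+ x. epowr (f (t * x)) r \<partial>pos_line)"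
    by (intro nn_integral_pos_line_scale t) measurable
  moreover have "real_of_ereal (1 / q) = 1 / r"
    using 2 by (simp add: one_ereal_def)
  ultimately show ?thesis
    using 2 t by (simp add: Lq_norm_finite_exponent epowr_mult epowr_ennreal)
qed

lemma Lq_norm_eq_0D:
  assumes q: "0 < q" and f [measurable]: "f \<in> borel_measurable pos_line" and 0: "Lq_norm q f = 0"
  shows "AE x in pos_line. f x = 0"
  using q
proof (cases rule: pos_ereal_cases)
  case 1
  then show ?thesis using esssup_AE[of f pos_line] 0 by (simp add: Lq_norm_def)
next
  case (2 r)
  then show ?thesis
    using 0 by (simp add: Lq_norm_finite_exponent epowr_eq_0_iff nn_integral_0_iff_AE)
qed

section \<open>Rearrangements: dilations, steps and nonzero functions\<close>

lemma borel_measurable_antimono_ennreal: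
  fixes g :: "real \<Rightarrow> ennreal"
  assumes "antimono g"
  shows "g \<in> borel_measurable borel"
proof (rule borel_measurableI_greater)
  fix y
  have "is_interval {x. y < g x}"
    unfolding is_interval_1 using less_le_trans[OF _ antimonoD[OF assms]] by blast
  then show "{x \<in> space borel. y < g x} \<in> sets borel"
    by (simp add: real_interval_borel_measurable)
qed

lemma borel_measurable_mono_ennreal:
  fixes g :: "real \<Rightarrow> ennreal"
  assumes "mono g"
  shows "g \<in> borel_measurable borel"
proof (rule borel_measurableI_greater)
  fix y
  have "is_interval {x. y < g x}"
    unfolding is_interval_1 using less_le_trans[OF _ monoD[OF assms]] by blast
  then show "{x \<in> space borel. y < g x} \<in> sets borel"
    by (simp add: real_interval_borel_measurable)
qed

lemma borel_measurable_pos_lineI: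
  "g \<in> borel_measurable borel \<Longrightarrow> g \<in> borel_measurable pos_line"
  by (intro measurable_restrict_space1 measurable_completion) simp

text \<open>Antitone on the whole real line, not only on (0, infinity), because
  \<open>ennreal\<close> sends negative t to 0. Later statements can thus quantify over globally
  antitone functions.\<close>

lemma antimono_rearr: "antimono (rearr M f)"
proof
  fix t u :: real assume "t \<le> u"
  then have "ennreal t \<le> ennreal u" by (rule ennreal_leI)
  then show "rearr M f u \<le> rearr M f t"
    unfolding rearr_def by (intro INF_superset_mono) auto
qed

text \<open>For a nonmeasurable A both sides are 0: a set and its dilate are measurable together,
  and \<open>emeasure\<close> is 0 off the sigma-algebra.\<close>

lemma emeasure_half_line_scale:
  assumes t: "0 < t" and A: "A \<subseteq> {0..}"
  shows "emeasure half_line ((*) t ` A) = ennreal t * emeasure half_line A"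
proof -
  have "emeasure half_line ((*) t ` A) = emeasure lebesgue ((*) t ` A)"
    using t A by (intro emeasure_restrict_space) auto
  also have "\<dots> = ennreal t * emeasure lebesgue A"
    using emeasure_lebesgue_affine[of t 0 A] t by simp
  also have "emeasure lebesgue A = emeasure half_line A"
    using A by (intro emeasure_restrict_space[symmetric]) auto
  finally show ?thesis .
qed

lemma rearr_dilate:
  assumes t: "0 < t"
  shows "rearr half_line (dilate (1 / t) f) u = rearr half_line f (u / t)"
proof -
  have "emeasure half_line {x \<in> space half_line. emod (dilate (1 / t) f x) > ennreal s} \<le> ennreal u
     \<longleftrightarrow> emeasure half_line {x \<in> space half_line. emod (f x) > ennreal s} \<le> ennreal (u / t)" for s
  proof -
    have "{x \<in> space half_line. emod (dilate (1 / t) f x) > ennreal s}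
        = (*) t ` {x \<in> space half_line. emod (f x) > ennreal s}" (is "?L = _ ` ?R")
    proof (intro equalityI subsetI)
      fix x assume "x \<in> ?L"
      then have "x / t \<in> ?R" using t by (simp add: dilate_def)
      then show "x \<in> (*) t ` ?R" using t by (intro image_eqI[of _ _ "x / t"]) auto
    qed (use t in \<open>auto simp: dilate_def\<close>)
    moreover have "emeasure half_line ((*) t ` ?R) = ennreal t * emeasure half_line ?R"
      by (intro emeasure_half_line_scale t) auto
    \<comment> \<open>Negative u is covered too: u and u / t have the same sign, so both bounds are
      then 0.\<close>
    moreover have "ennreal t * m \<le> ennreal u \<longleftrightarrow> m \<le> ennreal (u / t)" for m
    proof (cases m)
      case (real r)
      have "ennreal t * m = ennreal (t * r)"
        using real t by (simp add: ennreal_mult)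
      moreover have "t * r \<le> u \<longleftrightarrow> r \<le> u / t" "t * r \<le> 0 \<longleftrightarrow> r \<le> 0"
        using t by (auto simp: pos_le_divide_eq mult.commute mult_le_0_iff)
      moreover have "u / t \<le> 0 \<longleftrightarrow> u \<le> 0" "0 \<le> u / t \<longleftrightarrow> 0 \<le> u"
        using t by (auto simp: divide_le_0_iff zero_le_divide_iff)
      ultimately show ?thesis using real by (simp add: ennreal_le_iff2)
    next
      case top
      then show ?thesis using t by (simp add: ennreal_mult_top top_unique)
    qed
    ultimately show ?thesis by simp
  qed
  then show ?thesis by (simp add: rearr_def)
qed

text \<open>On the half-line this is c times the indicator of [0, a). Using the ray
  \<open>{..<a}\<close> makes its dilations and its rearrangement come out as exact identities of
  functions on all reals, negative arguments included.\<close>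

definition step :: "real \<Rightarrow> real \<Rightarrow> real \<Rightarrow> ecomplex" where
  "step c a s = Some (if s \<in> {..<a} then complex_of_real c else 0)"

lemma step_measurable: "step c a \<in> measurable_functions half_line"
  unfolding measurable_functions_def
proof (rule measurableI)
  fix x show "step c a x \<in> space ecomplex_borel" by (simp add: ecomplex_borel_def space_measure_of_conv)
next
  fix A
  have "step c a -` A = (if Some (complex_of_real c) \<in> A then {..<a} else {}) \<union>
      (if Some 0 \<in> A then - {..<a} else {})"
    by (auto simp: step_def split: if_splits)
  then have "step c a -` A \<in> sets lebesgue" by auto
  then show "step c a -` A \<inter> space half_line \<in> sets half_line"
    by (auto simp: sets_restrict_space)
qed

lemma dilate_step: "0 < t \<Longrightarrow> dilate (1 / t) (step c a) = step c (t * a)"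
  by (auto simp: dilate_def step_def fun_eq_iff field_simps)

lemma rearr_step:
  assumes "0 < c" "0 < a"
  shows "rearr half_line (step c a) t = ennreal c * indicator {..<a} t"
proof -
  have *: "emeasure half_line {x \<in> space half_line. emod (step c a x) > ennreal s} = (if s < c then ennreal a else 0)"
    if "0 \<le> s" for s
  proof -
    have "{x \<in> space half_line. emod (step c a x) > ennreal s} = (if s < c then {0..<a} else {})"
      using that assms by (auto simp: step_def emod_def ennreal_less_iff)
    moreover have "emeasure half_line {0..<a} = ennreal a"
      using assms by (subst emeasure_restrict_space) auto
    ultimately show ?thesis by simp
  qed
  \<comment> \<open>For 0 \<le> s < c the condition reads \<open>ennreal a \<le> ennreal t\<close>,
    which fails for every t < a, negative t included, since a > 0. For s \<ge> c the level set is
    empty.\<close>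
  have eq: "{s. 0 \<le> s \<and> emeasure half_line {x \<in> space half_line. emod (step c a x) > ennreal s} \<le> ennreal t}
     = (if t < a then {c..} else {0..})"
  proof (rule set_eqI)
    fix s
    show "s \<in> {s. 0 \<le> s \<and> emeasure half_line {x \<in> space half_line. emod (step c a x) > ennreal s} \<le> ennreal t}
       \<longleftrightarrow> s \<in> (if t < a then {c..} else {0..})"
    proof (cases "0 \<le> s")
      case True
      then show ?thesis
        unfolding mem_Collect_eq *[OF True] using assms by (auto simp: ennreal_le_iff2)
    qed (use assms in auto)
  qed
  show ?thesis
  proof (cases "t < a")
    case True
    then show ?thesis unfolding rearr_def eq
      by (auto intro!: antisym INF_greatest INF_lower2[of c] ennreal_leI)
  next
    case False
    then show ?thesis unfolding rearr_def eq
      by (auto intro!: antisym INF_lower2[of 0])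
  qed
qed

text \<open>Neighbourhoods of the point at infinity are complements of closed compact sets, here of
  a closed disc. A negative s gives the disc of radius 0, as \<open>ennreal s\<close> is then
  0.\<close>

lemma emod_greater_open: "{z. emod z > ennreal s} \<in> sets ecomplex_borel"
proof -
  have "{z. emod z > ennreal s} = insert None (Some ` (UNIV - {w. ennreal (cmod w) \<le> ennreal s}))"
  proof (rule set_eqI)
    fix z show "z \<in> {z. emod z > ennreal s} \<longleftrightarrow>
        z \<in> insert None (Some ` (UNIV - {w. ennreal (cmod w) \<le> ennreal s}))"
      by (cases z) (simp_all add: emod_def not_le image_iff)
  qed
  moreover have "compact {w. ennreal (cmod w) \<le> ennreal s}"
  proof -
    have "{w. ennreal (cmod w) \<le> ennreal s} = cball 0 (max 0 s)"
      by (auto simp: ennreal_le_iff2 max_def)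
    then show ?thesis by simp
  qed
  ultimately have "openin (Alexandroff_compactification euclidean) {z. emod z > ennreal s}"
    by (auto simp: openin_Alexandroff_compactification compact_imp_closed)
  then show ?thesis unfolding ecomplex_borel_def by (simp add: sets_measure_of_conv)
qed

lemma emod_greater_sets:
  assumes "f \<in> measurable_functions M"
  shows "{x \<in> space M. emod (f x) > ennreal s} \<in> sets M"
  using measurable_sets[OF assms[unfolded measurable_functions_def] emod_greater_open[of s]]
  by (simp add: vimage_def Int_def conj_commute)

text \<open>The set where f is nonzero is the countable union of the level sets at heights 1 / (n +
  1), so one of these has positive measure. That height serves as c, and a is any positive real not
  exceeding the measure.\<close>

lemma rearr_nonzero:
  assumes f: "f \<in> measurable_functions M" and nz: "\<not> (AE x in M. f x = Some 0)"
  obtains c a where "0 < c" "0 < a" "\<And>t. ennreal c * indicator {..<a} t \<le> rearr M f t"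
proof -
  let ?S = "\<lambda>s. {x \<in> space M. emod (f x) > ennreal s}"
  have "\<exists>n::nat. emeasure M (?S (1 / real (Suc n))) \<noteq> 0"
  proof (rule ccontr)
    assume "\<not> ?thesis"
    then have "(\<Union>n::nat. ?S (1 / real (Suc n))) \<in> null_sets M"
      using emod_greater_sets[OF f] by (intro null_sets_UN) (auto simp: null_sets_def)
    then have "AE x in M. x \<notin> (\<Union>n::nat. ?S (1 / real (Suc n)))" by (rule AE_not_in)
    then have "AE x in M. f x = Some 0"
    proof (rule AE_mp, intro AE_I2 impI)
      fix x assume x: "x \<in> space M" "x \<notin> (\<Union>n::nat. ?S (1 / real (Suc n)))"
      then have le: "emod (f x) \<le> ennreal (1 / real (Suc n))" for n
        by (auto simp: not_less)
      obtain w where w: "f x = Some w"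
        using le[of 0] by (cases "f x") (auto simp: emod_def top_unique)
      have "cmod w \<le> 1 / real (Suc n)" for n
        using le[of n] by (auto simp: w emod_def ennreal_le_iff2)
      then have "\<not> 0 < cmod w"
        using reals_Archimedean[of "cmod w"] by (metis inverse_eq_divide not_le)
      then show "f x = Some 0" using w by simp
    qed
    with nz show False by simp
  qed
  then obtain n :: nat where n: "emeasure M (?S (1 / real (Suc n))) \<noteq> 0" by blast
  define c where "c = 1 / real (Suc n)"
  have c: "0 < c" by (simp add: c_def)
  \<comment> \<open>The level set may have infinite measure; then 1 is as good as any other
    value.\<close>
  obtain a where a: "0 < a" "ennreal a \<le> emeasure M (?S c)"
  proof (cases "emeasure M (?S c)")
    case (real r)
    then show ?thesis using n that[of r] by (auto simp: c_def)
  next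
    case top
    then show ?thesis using that[of 1] by auto
  qed
  have "ennreal c * indicator {..<a} t \<le> rearr M f t" for t
  proof (cases "t < a")
    case True
    \<comment> \<open>For s < c the level set at s contains the one at c, so its measure is at least
      a > t and s is not admissible in the infimum.\<close>
    have "ennreal c \<le> ennreal s" if s: "0 \<le> s" "emeasure M (?S s) \<le> ennreal t" for s
    proof (rule ennreal_leI, rule ccontr)
      assume "\<not> c \<le> s"
      then have "emeasure M (?S c) \<le> emeasure M (?S s)"
        by (intro emeasure_mono emod_greater_sets[OF f]) (auto elim!: le_less_trans[OF ennreal_leI, rotated])
      with a(2) s(2) have "ennreal a \<le> ennreal t" by (meson order_trans)
      then show False using True a(1) by (simp add: ennreal_le_iff2)
    qed
    then show ?thesis unfolding rearr_def using True by (auto intro!: INF_greatest)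
  qed auto
  with c a(1) show ?thesis by (rule that)
qed

section \<open>A uniform dilation bound for slowly varying functions\<close>

text \<open>A Potter bound. For t \<le> 1 the almost increasing v^\<epsilon> b(v) is compared at t v
  and v, for t \<ge> 1 the almost decreasing v^(-\<epsilon>) b(v). The losses t^(-\<epsilon>) and
  t^\<epsilon> are both e^(\<epsilon> |ln t|) in their range, and the larger of the two constants
  serves all t.\<close>

lemma slowly_varying_dilate_le:
  assumes b: "slowly_varying b" and e: "0 < \<epsilon>"
  obtains C where "0 < C" "\<And>t v. 0 < t \<Longrightarrow> 0 < v \<Longrightarrow> b (t * v) \<le> C * exp (\<epsilon> * \<bar>ln t\<bar>) * b v"
proof -
  have bpos: "0 < b t" if "0 < t" for t using b that by (simp add: slowly_varying_def)
  obtain g where g_mono: "mono_on {0<..} g" and "approx_on {0<..} (\<lambda>t. t powr \<epsilon> * b t) g"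
    using b e unfolding slowly_varying_def by blast
  then obtain c1 C1 where g: "0 < c1" "0 < C1"
    "\<And>t. 0 < t \<Longrightarrow> c1 * g t \<le> t powr \<epsilon> * b t" "\<And>t. 0 < t \<Longrightarrow> t powr \<epsilon> * b t \<le> C1 * g t"
    unfolding approx_on_def by auto
  obtain h where h_antimono: "antimono_on {0<..} h"
    and "approx_on {0<..} (\<lambda>t. t powr (-\<epsilon>) * b t) h"
    using b e unfolding slowly_varying_def by blast
  then obtain c2 C2 where h: "0 < c2" "0 < C2"
    "\<And>t. 0 < t \<Longrightarrow> c2 * h t \<le> t powr (-\<epsilon>) * b t" "\<And>t. 0 < t \<Longrightarrow> t powr (-\<epsilon>) * b t \<le> C2 * h t"
    unfolding approx_on_def by auto
  \<comment> \<open>Going up to the monotone comparison function and back down costs the ratio of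
    its two equivalence constants.\<close>
  have chain: "x \<le> D / d * y"
    if "x \<le> D * u" "u \<le> w" "d * w \<le> y" "0 < d" "0 < D" for x y u w d D :: real
  proof -
    have "x \<le> D * w" using that by (meson mult_left_mono order_trans less_imp_le)
    also have "\<dots> = D / d * (d * w)" using that by simp
    also have "\<dots> \<le> D / d * y" using that by (intro mult_left_mono) auto
    finally show ?thesis .
  qed
  have small: "b (t * v) \<le> C1 / c1 * exp (\<epsilon> * \<bar>ln t\<bar>) * b v" if t: "0 < t" "t \<le> 1" "0 < v" for t v
  proof -
    have "t * v \<le> v" using t by simp
    then have "(t * v) powr \<epsilon> * b (t * v) \<le> C1 / c1 * (v powr \<epsilon> * b v)"
      using t g monotone_onD[OF g_mono, of "t * v" v]
      by (intro chain[of _ C1 "g (t * v)" "g v"]) auto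
    then have "v powr \<epsilon> * (t powr \<epsilon> * b (t * v)) \<le> v powr \<epsilon> * (C1 / c1 * b v)"
      using t by (simp add: powr_mult algebra_simps)
    then have "t powr \<epsilon> * b (t * v) \<le> C1 / c1 * b v"
      using t by (subst (asm) mult_le_cancel_left_pos) auto
    then have "exp (\<epsilon> * \<bar>ln t\<bar>) * (t powr \<epsilon> * b (t * v)) \<le> exp (\<epsilon> * \<bar>ln t\<bar>) * (C1 / c1 * b v)"
      by (intro mult_left_mono) auto
    moreover have "exp (\<epsilon> * \<bar>ln t\<bar>) * t powr \<epsilon> = 1"
      using t by (simp add: powr_def flip: exp_add)
    ultimately show ?thesis by (metis mult.assoc mult.commute mult_1)
  qed
  have large: "b (t * v) \<le> C2 / c2 * exp (\<epsilon> * \<bar>ln t\<bar>) * b v" if t: "1 \<le> t" "0 < v" for t v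
  proof -
    have t0: "0 < t" using t by simp
    have "v \<le> t * v" using t by simp
    then have "(t * v) powr (-\<epsilon>) * b (t * v) \<le> C2 / c2 * (v powr (-\<epsilon>) * b v)"
      using t t0 h monotone_onD[OF h_antimono, of v "t * v"]
      by (intro chain[of _ C2 "h (t * v)" "h v"]) auto
    then have "v powr (-\<epsilon>) * (t powr (-\<epsilon>) * b (t * v)) \<le> v powr (-\<epsilon>) * (C2 / c2 * b v)"
      using t t0 by (simp add: powr_mult algebra_simps)
    then have "t powr (-\<epsilon>) * b (t * v) \<le> C2 / c2 * b v"
      using t by (subst (asm) mult_le_cancel_left_pos) auto
    then have "exp (\<epsilon> * \<bar>ln t\<bar>) * (t powr (-\<epsilon>) * b (t * v)) \<le> exp (\<epsilon> * \<bar>ln t\<bar>) * (C2 / c2 * b v)"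
      by (intro mult_left_mono) auto
    moreover have "exp (\<epsilon> * \<bar>ln t\<bar>) * t powr (-\<epsilon>) = 1"
      using t t0 by (simp add: powr_def flip: exp_add)
    ultimately show ?thesis by (metis mult.assoc mult.commute mult_1)
  qed
  show thesis
  proof
    show "0 < max (C1 / c1) (C2 / c2)" using g h by (simp add: less_max_iff_disj)
    fix t v :: real assume t: "0 < t" "0 < v"
    have "C1 / c1 * exp (\<epsilon> * \<bar>ln t\<bar>) * b v \<le> max (C1 / c1) (C2 / c2) * exp (\<epsilon> * \<bar>ln t\<bar>) * b v"
      "C2 / c2 * exp (\<epsilon> * \<bar>ln t\<bar>) * b v \<le> max (C1 / c1) (C2 / c2) * exp (\<epsilon> * \<bar>ln t\<bar>) * b v"
      using bpos[OF t(2)] by (intro mult_right_mono; simp)+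
    then show "b (t * v) \<le> max (C1 / c1) (C2 / c2) * exp (\<epsilon> * \<bar>ln t\<bar>) * b v"
      using small[of t v] large[of t v] t by (cases "t \<le> 1") linarith+
  qed
qed

section \<open>Boyd indices from two-sided estimates of the dilation norm\<close>

text \<open>With x = ln t, the function g(x) = ln h(e^x) lies between \<alpha> x and K + \<alpha> x
  + \<epsilon> |x|. The lower line bounds every quotient g(x) / x, from below for x > 0 and from
  above for x < 0; the upper line shows that \<alpha> is approached for large |x|.\<close>

lemma boyd_indices_eqI:
  assumes upper: "\<And>\<epsilon>. 0 < \<epsilon> \<Longrightarrow>
      \<exists>C>0. \<forall>t>0. dilation_norm N t \<le> ennreal (C * t powr \<alpha> * exp (\<epsilon> * \<bar>ln t\<bar>))"
    and lower: "\<And>t. 0 < t \<Longrightarrow> ennreal (t powr \<alpha>) \<le> dilation_norm N t"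
  shows "lower_boyd N = ereal \<alpha>" and "upper_boyd N = ereal \<alpha>"
proof -
  define g where "g x = ln (enn2real (dilation_norm N (exp x)))" for x
  have fin: "dilation_norm N t < \<infinity>" if "0 < t" for t
    using upper[of 1] that by (auto intro: le_less_trans)
  have pos: "exp (\<alpha> * x) \<le> enn2real (dilation_norm N (exp x))" for x
    using enn2real_mono[OF lower[of "exp x"]] fin[of "exp x"] by (simp add: powr_def)
  have eln: "eln (dilation_norm N (exp x)) = ereal (g x)" for x
  proof -
    have "0 < enn2real (dilation_norm N (exp x))"
      using pos[of x] by (rule less_le_trans[rotated]) simp
    then show ?thesis
      using fin[of "exp x"] by (auto simp: eln_def g_def)
  qed
  have g_ge: "\<alpha> * x \<le> g x" for x
    using ln_mono[OF pos[of x]] by (simp add: g_def)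
  have g_le: "\<exists>K\<ge>0. \<forall>x. g x \<le> K + \<alpha> * x + \<epsilon> * \<bar>x\<bar>" if e: "0 < \<epsilon>" for \<epsilon>
  proof -
    obtain C where C: "0 < C" "\<forall>t>0. dilation_norm N t \<le> ennreal (C * t powr \<alpha> * exp (\<epsilon> * \<bar>ln t\<bar>))"
      using upper[OF e] by blast
    have "g x \<le> \<bar>ln C\<bar> + \<alpha> * x + \<epsilon> * \<bar>x\<bar>" for x
    proof -
      have "enn2real (dilation_norm N (exp x)) \<le> C * exp (\<alpha> * x) * exp (\<epsilon> * \<bar>x\<bar>)"
        using enn2real_mono[OF C(2)[rule_format, of "exp x"]] C(1) by (simp add: powr_def)
      then have "g x \<le> ln (C * exp (\<alpha> * x) * exp (\<epsilon> * \<bar>x\<bar>))"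
        unfolding g_def using pos[of x] C(1) by (intro ln_mono) (auto intro: less_le_trans[OF exp_gt_zero])
      then show ?thesis using C(1) by (simp add: ln_mult)
    qed
    then show ?thesis by (intro exI[of _ "\<bar>ln C\<bar>"]) auto
  qed
  have approx: "\<exists>x>0. g x \<le> (\<alpha> + \<epsilon>) * x \<and> g (- x) \<le> (\<alpha> - \<epsilon>) * (- x)" if e: "0 < \<epsilon>" for \<epsilon>
  proof -
    obtain K where K: "0 \<le> K" "\<forall>x. g x \<le> K + \<alpha> * x + (\<epsilon> / 2) * \<bar>x\<bar>"
      using g_le[of "\<epsilon> / 2"] e by auto
    \<comment> \<open>Half of \<epsilon> is kept in reserve to absorb K, which is at most
      (\<epsilon> / 2) x for this x; the summand 1 keeps x positive when K = 0.\<close>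
    define x where "x = 2 * K / \<epsilon> + 1"
    have x: "0 < x" "K \<le> (\<epsilon> / 2) * x"
      using K(1) e by (auto simp: x_def field_simps add_pos_nonneg)
    show ?thesis
      using x K(2)[rule_format, of x] K(2)[rule_format, of "- x"]
      by (intro exI[of _ x]) (auto simp: algebra_simps)
  qed
  show "upper_boyd N = ereal \<alpha>"
    unfolding upper_boyd_def
  proof (rule antisym)
    show "(INF t\<in>{1<..}. eln (dilation_norm N t) / ereal (ln t)) \<le> ereal \<alpha>"
    proof (rule ereal_le_epsilon2)
      fix \<epsilon> :: real assume "0 < \<epsilon>"
      with approx obtain x where x: "0 < x" "g x \<le> (\<alpha> + \<epsilon>) * x" by blast
      have "(INF t\<in>{1<..}. eln (dilation_norm N t) / ereal (ln t))
          \<le> eln (dilation_norm N (exp x)) / ereal (ln (exp x))"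
        using x by (intro INF_lower) simp
      also have "\<dots> \<le> ereal \<alpha> + ereal \<epsilon>"
        using x by (simp add: eln pos_divide_le_eq)
      finally show "(INF t\<in>{1<..}. eln (dilation_norm N t) / ereal (ln t)) \<le> ereal \<alpha> + ereal \<epsilon>" .
    qed
    show "ereal \<alpha> \<le> (INF t\<in>{1<..}. eln (dilation_norm N t) / ereal (ln t))"
    proof (rule INF_greatest)
      fix t :: real assume t: "t \<in> {1<..}"
      then show "ereal \<alpha> \<le> eln (dilation_norm N t) / ereal (ln t)"
        using g_ge[of "ln t"] eln[of "ln t"] by (simp add: pos_le_divide_eq)
    qed
  qed
  show "lower_boyd N = ereal \<alpha>"
    unfolding lower_boyd_def
  proof (rule antisym)
    show "ereal \<alpha> \<le> (SUP t\<in>{0<..<1}. eln (dilation_norm N t) / ereal (ln t))"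
    proof (rule ereal_le_epsilon2)
      fix \<epsilon> :: real assume "0 < \<epsilon>"
      with approx obtain x where x: "0 < x" "g (- x) \<le> (\<alpha> - \<epsilon>) * (- x)" by blast
      have "\<alpha> - \<epsilon> \<le> g (- x) / (- x)"
        using x by (subst neg_le_divide_eq) auto
      then have "ereal (\<alpha> - \<epsilon>) \<le> eln (dilation_norm N (exp (- x))) / ereal (ln (exp (- x)))"
        using x by (simp add: eln)
      also have "\<dots> \<le> (SUP t\<in>{0<..<1}. eln (dilation_norm N t) / ereal (ln t))"
        using x by (intro SUP_upper) simp
      finally show "ereal \<alpha> \<le> (SUP t\<in>{0<..<1}. eln (dilation_norm N t) / ereal (ln t)) + ereal \<epsilon>"
        by (subst (asm) ereal_minus(1)[symmetric], subst (asm) ereal_minus_le) auto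
    qed
    show "(SUP t\<in>{0<..<1}. eln (dilation_norm N t) / ereal (ln t)) \<le> ereal \<alpha>"
    proof (rule SUP_least)
      fix t :: real assume t: "t \<in> {0<..<1}"
      then show "eln (dilation_norm N t) / ereal (ln t) \<le> ereal \<alpha>"
        using g_ge[of "ln t"] eln[of "ln t"] by (simp add: neg_divide_le_eq)
    qed
  qed
qed

text \<open>
  Iterating \<open>\<phi> (t a) \<le> h \<phi> a\<close> costs the factor \<open>C\<close> only once, and \<open>\<epsilon>\<close> is arbitrary.
\<close>

lemma powr_le_dilation_factor:
  fixes \<phi> :: "real \<Rightarrow> real"
  assumes t: "0 < t" and pos: "\<And>a. 0 < a \<Longrightarrow> 0 < \<phi> a" and h: "\<And>a. 0 < a \<Longrightarrow> \<phi> (t * a) \<le> h * \<phi> a"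
    and upper: "\<And>\<epsilon>. 0 < \<epsilon> \<Longrightarrow>
      \<exists>C>0. \<forall>s>0. \<forall>a>0. \<phi> (s * a) \<le> C * s powr \<alpha> * exp (\<epsilon> * \<bar>ln s\<bar>) * \<phi> a"
  shows "t powr \<alpha> \<le> h"
proof -
  have "0 < h * \<phi> 1"
    using pos[of t] pos[of 1] h[of 1] t by simp
  then have h0: "0 < h" using pos[of 1] by (simp add: zero_less_mult_iff)
  have iter: "\<phi> (t ^ n) \<le> h ^ n * \<phi> 1" for n
  proof (induction n)
    case (Suc n)
    have "\<phi> (t ^ Suc n) \<le> h * \<phi> (t ^ n)" using h[of "t ^ n"] t by simp
    also have "\<dots> \<le> h * (h ^ n * \<phi> 1)" using Suc h0 by (intro mult_left_mono) auto
    finally show ?case by (simp add: mult.assoc)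
  qed simp
  have main: "t powr \<alpha> \<le> h * exp (\<epsilon> * \<bar>ln t\<bar>)" if e: "0 < \<epsilon>" for \<epsilon>
  proof (rule ccontr)
    assume neg: "\<not> ?thesis"
    \<comment> \<open>The supposed failure means r < 1. Going from 1 to t^n by \<open>iter\<close>
      and back by the dilation 1 / t^n gives 1 \<le> C r^n with C independent of n, which
      contradicts the geometric decay of r^n.\<close>
    define r where "r = h * exp (\<epsilon> * \<bar>ln t\<bar>) * exp (- (\<alpha> * ln t))"
    have "t powr \<alpha> * exp (- (\<alpha> * ln t)) = 1" using t by (simp add: powr_def flip: exp_add)
    moreover have "r < t powr \<alpha> * exp (- (\<alpha> * ln t))"
      unfolding r_def using neg by (intro mult_strict_right_mono) auto
    ultimately have r: "0 < r" "r < 1" using h0 by (simp_all add: r_def)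
    obtain C where C: "0 < C" "\<forall>s>0. \<forall>a>0. \<phi> (s * a) \<le> C * s powr \<alpha> * exp (\<epsilon> * \<bar>ln s\<bar>) * \<phi> a"
      using upper[OF e] by blast
    have "1 \<le> C * r ^ n" for n
    proof -
      let ?s = "1 / t ^ n"
      have ln: "ln ?s = - (real n * ln t)" using t by (simp add: ln_div ln_realpow)
      have abs: "\<bar>ln ?s\<bar> = real n * \<bar>ln t\<bar>" unfolding ln by (simp add: abs_mult)
      have "\<phi> 1 \<le> C * ?s powr \<alpha> * exp (\<epsilon> * \<bar>ln ?s\<bar>) * \<phi> (t ^ n)"
        using C(2)[rule_format, of ?s "t ^ n"] t by simp
      also have "\<dots> \<le> C * ?s powr \<alpha> * exp (\<epsilon> * \<bar>ln ?s\<bar>) * (h ^ n * \<phi> 1)"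
        using iter[of n] C(1) by (intro mult_left_mono) auto
      also have "?s powr \<alpha> = exp (- (\<alpha> * ln t)) ^ n"
        using t by (simp only: powr_def ln) (simp add: exp_of_nat_mult[symmetric] algebra_simps)
      also have "exp (\<epsilon> * \<bar>ln ?s\<bar>) = exp (\<epsilon> * \<bar>ln t\<bar>) ^ n"
        unfolding abs by (simp add: exp_of_nat_mult[symmetric] algebra_simps)
      also have "C * exp (- (\<alpha> * ln t)) ^ n * exp (\<epsilon> * \<bar>ln t\<bar>) ^ n * (h ^ n * \<phi> 1) = C * r ^ n * \<phi> 1"
        by (simp add: r_def power_mult_distrib)
      finally show ?thesis using pos[of 1] by simp
    qed
    moreover have "(\<lambda>n. C * r ^ n) \<longlonglongrightarrow> C * 0"
      using r by (intro tendsto_mult_left LIMSEQ_power_zero) simp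
    ultimately have "1 \<le> C * 0" by (intro LIMSEQ_le_const) auto
    then show False by simp
  qed
  \<comment> \<open>Since h does not depend on \<epsilon>, letting \<epsilon> decrease to 0 removes
    the last error factor.\<close>
  have "((\<lambda>\<epsilon>. h * exp (\<epsilon> * \<bar>ln t\<bar>)) \<longlongrightarrow> h * exp (0 * \<bar>ln t\<bar>)) (at_right 0)"
    by (intro tendsto_intros)
  moreover have "eventually (\<lambda>\<epsilon>. t powr \<alpha> \<le> h * exp (\<epsilon> * \<bar>ln t\<bar>)) (at_right 0)"
    using main by (auto simp: eventually_at_right_less intro: eventually_mono[OF eventually_at_right_less])
  ultimately show ?thesis
    by (auto dest: tendsto_lowerbound)
qed

section \<open>One weighted functional for f* and f**\<close>

text \<open>Collects what the identity and the mean over (0, t) have in common, so that one argument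
  covers both norms. Rearrangements are antitone, hence the restriction on g;
  \<open>indicator_pos\<close> keeps the norms of steps away from 0.\<close>

locale dilation_equivariant =
  fixes T :: "(real \<Rightarrow> ennreal) \<Rightarrow> real \<Rightarrow> ennreal"
  assumes measurable: "antimono g \<Longrightarrow> T g \<in> borel_measurable pos_line"
    and dilate: "antimono g \<Longrightarrow> 0 < t \<Longrightarrow> 0 < u \<Longrightarrow> T (\<lambda>v. g (v / t)) u = T g (u / t)"
    and cmult: "antimono g \<Longrightarrow> T (\<lambda>v. ennreal c * g v) u = ennreal c * T g u"
    and mono: "(\<And>v. f v \<le> g v) \<Longrightarrow> T f u \<le> T g u"
    and indicator_pos: "0 < u \<Longrightarrow> u < a \<Longrightarrow> 0 < T (indicator {..<a}) u"

lemma antimono_indicator_lessThan: "antimono (indicator {..<a} :: real \<Rightarrow> ennreal)"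
  by (auto simp: antimono_def indicator_def)

locale lorentz_karamata = dilation_equivariant +
  fixes p q :: ereal and b :: "real \<Rightarrow> real"
  assumes p: "0 < p" and q: "0 < q" and b: "slowly_varying b"
begin

text \<open>At \<open>rearr half_line f\<close> this is \<open>LK_norm\<close> or
  \<open>LK_max_norm\<close>, according to the choice of T.\<close>

definition lk :: "(real \<Rightarrow> ennreal) \<Rightarrow> ennreal" where
  "lk g = Lq_norm q (\<lambda>t. ennreal (t powr real_of_ereal (1 / p - 1 / q) * b t) * T g t)"

abbreviation \<alpha> :: real where "\<alpha> \<equiv> real_of_ereal (1 / p)"

lemma exponent: "1 / p = ereal \<alpha>" "real_of_ereal (1 / p - 1 / q) = \<alpha> - real_of_ereal (1 / q)"
  using p q by (cases p; cases q; simp add: one_ereal_def)+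

lemma weight_measurable:
  "(\<lambda>t. ennreal (t powr real_of_ereal (1 / p - 1 / q) * b t)) \<in> borel_measurable pos_line"
proof -
  have [measurable]: "b \<in> borel_measurable pos_line"
    using b by (simp add: slowly_varying_def)
  have [measurable]: "(\<lambda>t::real. t) \<in> borel_measurable pos_line"
    by (intro borel_measurable_pos_lineI) auto
  show ?thesis by measurable
qed

lemma lk_integrand_measurable:
  "antimono g \<Longrightarrow>
    (\<lambda>t. ennreal (t powr real_of_ereal (1 / p - 1 / q) * b t) * T g t) \<in> borel_measurable pos_line"
  by (intro borel_measurable_times_ennreal weight_measurable measurable)

lemma lk_mono: "antimono f \<Longrightarrow> (\<And>v. f v \<le> g v) \<Longrightarrow> lk f \<le> lk g"
  unfolding lk_def by (intro Lq_norm_mono q lk_integrand_measurable mult_left_mono mono) auto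

lemma lk_cmult:
  assumes g: "antimono g" and c: "0 < c"
  shows "lk (\<lambda>v. ennreal c * g v) = ennreal c * lk g"
  unfolding lk_def
  using Lq_norm_cmult[OF q lk_integrand_measurable[OF g] c]
  by (simp add: cmult[OF g] mult.left_commute)

text \<open>The substitution contributes t^(1/q), the power in the weight t^(1/p - 1/q), and b the
  factor C e^(\<epsilon> |ln t|). The two powers of 1/q cancel, which is why only p survives in the
  exponent.\<close>

lemma lk_dilate_le:
  assumes e: "0 < \<epsilon>"
  obtains C where "0 < C" "\<And>t g. 0 < t \<Longrightarrow> antimono g \<Longrightarrow>
    lk (\<lambda>v. g (v / t)) \<le> ennreal (C * t powr \<alpha> * exp (\<epsilon> * \<bar>ln t\<bar>)) * lk g"
proof -
  obtain C where C: "0 < C"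
    "\<And>t v. 0 < t \<Longrightarrow> 0 < v \<Longrightarrow> b (t * v) \<le> C * exp (\<epsilon> * \<bar>ln t\<bar>) * b v"
    using slowly_varying_dilate_le[OF b e] by blast
  let ?\<beta> = "real_of_ereal (1 / q)" and ?\<gamma> = "real_of_ereal (1 / p - 1 / q)"
  let ?w = "\<lambda>t. t powr ?\<gamma> * b t"
  have bpos: "0 < b t" if "0 < t" for t using b that by (simp add: slowly_varying_def)
  have "lk (\<lambda>v. g (v / t)) \<le> ennreal (C * t powr \<alpha> * exp (\<epsilon> * \<bar>ln t\<bar>)) * lk g"
    if t: "0 < t" and g: "antimono g" for t and g :: "real \<Rightarrow> ennreal"
  proof -
    let ?K = "t powr ?\<gamma> * (C * exp (\<epsilon> * \<bar>ln t\<bar>))"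
    have gt: "antimono (\<lambda>v. g (v / t))"
      using t by (intro antimonoI antimonoD[OF g] divide_right_mono) auto
    have K: "0 < ?K" using t C(1) by simp
    have "lk (\<lambda>v. g (v / t))
        = ennreal (t powr ?\<beta>) * Lq_norm q (\<lambda>v. ennreal (?w (t * v)) * T (\<lambda>v. g (v / t)) (t * v))"
      unfolding lk_def by (rule Lq_norm_scale[OF q lk_integrand_measurable[OF gt] t])
    also have "\<dots> \<le> ennreal (t powr ?\<beta>) * Lq_norm q (\<lambda>v. ennreal ?K * (ennreal (?w v) * T g v))"
    proof (intro mult_left_mono Lq_norm_mono q)
      show "(\<lambda>v. ennreal (?w (t * v)) * T (\<lambda>v. g (v / t)) (t * v)) \<in> borel_measurable pos_line"
        using measurable_compose[OF measurable_scale_pos_line[OF t] lk_integrand_measurable[OF gt]] .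
      fix v :: real assume v: "0 < v"
      have "?w (t * v) = t powr ?\<gamma> * v powr ?\<gamma> * b (t * v)"
        using t v by (simp add: powr_mult)
      also have "\<dots> \<le> t powr ?\<gamma> * v powr ?\<gamma> * (C * exp (\<epsilon> * \<bar>ln t\<bar>) * b v)"
        by (intro mult_left_mono C(2) t v) auto
      also have "\<dots> = ?K * ?w v" by (simp add: algebra_simps)
      finally have "ennreal (?w (t * v)) \<le> ennreal (?K * ?w v)" by (rule ennreal_leI)
      also have "\<dots> = ennreal ?K * ennreal (?w v)"
        using K bpos[OF v] by (intro ennreal_mult) auto
      finally have "ennreal (?w (t * v)) * T g v \<le> ennreal ?K * ennreal (?w v) * T g v"
        by (rule mult_right_mono) simp
      then show "ennreal (?w (t * v)) * T (\<lambda>v. g (v / t)) (t * v) \<le> ennreal ?K * (ennreal (?w v) * T g v)"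
        using dilate[OF g t, of "t * v"] t v by (simp add: mult.assoc)
    qed simp
    also have "\<dots> = ennreal (t powr ?\<beta> * ?K) * lk g"
      unfolding lk_def Lq_norm_cmult[OF q lk_integrand_measurable[OF g] K]
      using K by (simp only: ennreal_mult powr_ge_zero less_imp_le mult.assoc)
    also have "t powr ?\<beta> * ?K = C * t powr \<alpha> * exp (\<epsilon> * \<bar>ln t\<bar>)"
      by (simp add: exponent(2) powr_diff)
    finally show ?thesis .
  qed
  with C(1) show thesis by (rule that)
qed

text \<open>The fundamental function of the space, kept extended-valued because finiteness has to be
  deduced from nontriviality.\<close>

definition fundamental :: "real \<Rightarrow> ennreal" where
  "fundamental a = lk (indicator {..<a})"

lemma fundamental_dilate_le:
  assumes e: "0 < \<epsilon>"
  obtains C where "0 < C" "\<And>t a. 0 < t \<Longrightarrow>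
    fundamental (t * a) \<le> ennreal (C * t powr \<alpha> * exp (\<epsilon> * \<bar>ln t\<bar>)) * fundamental a"
proof -
  obtain C where C: "0 < C" "\<And>t g. 0 < t \<Longrightarrow> antimono g \<Longrightarrow>
    lk (\<lambda>v. g (v / t)) \<le> ennreal (C * t powr \<alpha> * exp (\<epsilon> * \<bar>ln t\<bar>)) * lk g"
    using lk_dilate_le[OF e] by blast
  have "(indicator {..<t * a} :: real \<Rightarrow> ennreal) = (\<lambda>v. indicator {..<a} (v / t))" if "0 < t" for t a
    using that by (auto simp: indicator_def fun_eq_iff field_simps)
  then show thesis
    using that[OF C(1)] C(2)[OF _ antimono_indicator_lessThan] by (simp add: fundamental_def)
qed

text \<open>Norm 0 would force the integrand to vanish almost everywhere, but weight and T of the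
  indicator are both positive on (0, a), a set of measure a.\<close>

lemma fundamental_pos:
  assumes a: "0 < a"
  shows "0 < fundamental a"
proof (rule ccontr)
  assume "\<not> ?thesis"
  then have "fundamental a = 0" by simp
  then have "AE t in pos_line. ennreal (t powr real_of_ereal (1 / p - 1 / q) * b t) * T (indicator {..<a}) t = 0"
    unfolding fundamental_def lk_def
    by (rule Lq_norm_eq_0D[OF q lk_integrand_measurable[OF antimono_indicator_lessThan]])
  then have "AE t in pos_line. t \<notin> {0<..<a}"
  proof (rule AE_mp, intro AE_I2 impI)
    fix t assume t: "t \<in> space pos_line"
      "ennreal (t powr real_of_ereal (1 / p - 1 / q) * b t) * T (indicator {..<a}) t = 0"
    then have "0 < t powr real_of_ereal (1 / p - 1 / q) * b t"
      using b by (simp add: slowly_varying_def)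
    with t show "t \<notin> {0<..<a}" using indicator_pos[of t a] by auto
  qed
  then have "emeasure pos_line {0<..<a} = 0"
    by (subst (asm) AE_iff_measurable[where N = "{0<..<a}"]) (auto simp: sets_restrict_space)
  moreover have "emeasure pos_line {0<..<a} = ennreal a"
    using a by (subst emeasure_restrict_space) auto
  ultimately show False using a by simp
qed

lemma boyd_indices:
  assumes fin: "0 < a" "fundamental a < \<infinity>"
  defines "N \<equiv> \<lambda>f. lk (rearr half_line f)"
  shows "lower_boyd N = 1 / p" "upper_boyd N = 1 / p"
proof -
  \<comment> \<open>Finiteness at a spreads to every a' through the dilation by a' / a; the choice
    \<epsilon> = 1 is arbitrary.\<close>
  have finite: "fundamental a' < \<infinity>" if "0 < a'" for a'
  proof -
    obtain C where C: "0 < C" "\<And>t a. 0 < t \<Longrightarrow>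
        fundamental (t * a) \<le> ennreal (C * t powr \<alpha> * exp (1 * \<bar>ln t\<bar>)) * fundamental a"
      using fundamental_dilate_le[OF zero_less_one] by blast
    have "fundamental (a' / a * a)
        \<le> ennreal (C * (a' / a) powr \<alpha> * exp (1 * \<bar>ln (a' / a)\<bar>)) * fundamental a"
      using that fin(1) by (intro C(2)) simp
    also have "\<dots> < \<infinity>" using fin(2) by (simp add: ennreal_mult_less_top)
    finally show ?thesis using fin(1) by simp
  qed
  define \<phi> where "\<phi> a = enn2real (fundamental a)" for a
  have \<phi>: "fundamental a = ennreal (\<phi> a)" "0 < \<phi> a" if "0 < a" for a
    using finite[OF that] fundamental_pos[OF that]
    by (auto simp: \<phi>_def enn2real_positive_iff less_top)
  have upper: "\<exists>C>0. \<forall>t>0. dilation_norm N t \<le> ennreal (C * t powr \<alpha> * exp (\<epsilon> * \<bar>ln t\<bar>))"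
    if e: "0 < \<epsilon>" for \<epsilon>
  proof -
    obtain C where C: "0 < C" "\<And>t g. 0 < t \<Longrightarrow> antimono g \<Longrightarrow>
      lk (\<lambda>v. g (v / t)) \<le> ennreal (C * t powr \<alpha> * exp (\<epsilon> * \<bar>ln t\<bar>)) * lk g"
      using lk_dilate_le[OF e] by blast
    have "dilation_norm N t \<le> ennreal (C * t powr \<alpha> * exp (\<epsilon> * \<bar>ln t\<bar>))" if t: "0 < t" for t
      unfolding dilation_norm_def
    proof (rule SUP_least)
      fix f assume f: "f \<in> {f \<in> measurable_functions half_line. N f \<le> 1}"
      have "N (dilate (1 / t) f) = lk (\<lambda>v. rearr half_line f (v / t))"
        by (simp add: N_def rearr_dilate[OF t, abs_def])
      also have "\<dots> \<le> ennreal (C * t powr \<alpha> * exp (\<epsilon> * \<bar>ln t\<bar>)) * N f"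
        unfolding N_def by (intro C(2) t antimono_rearr)
      also have "\<dots> \<le> ennreal (C * t powr \<alpha> * exp (\<epsilon> * \<bar>ln t\<bar>)) * 1"
        using f by (intro mult_left_mono) auto
      finally show "N (dilate (1 / t) f) \<le> ennreal (C * t powr \<alpha> * exp (\<epsilon> * \<bar>ln t\<bar>))" by simp
    qed
    with C(1) show ?thesis by blast
  qed
  have N_step: "N (step c a) = ennreal (c * \<phi> a)" if "0 < c" "0 < a" for c a
  proof -
    have "rearr half_line (step c a) = (\<lambda>t. ennreal c * indicator {..<a} t)"
      using rearr_step[OF that] by auto
    then have "N (step c a) = ennreal c * fundamental a"
      using lk_cmult[OF antimono_indicator_lessThan that(1)] by (simp add: N_def fundamental_def)
    then show ?thesis
      using that \<phi>[of a] by (simp add: ennreal_mult)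
  qed
  have lower: "ennreal (t powr \<alpha>) \<le> dilation_norm N t" if t: "0 < t" for t
  proof -
    have ratio: "ennreal (\<phi> (t * a) / \<phi> a) \<le> dilation_norm N t" if a: "0 < a" for a
    proof -
      \<comment> \<open>The height 1 / \<phi>(a) normalizes the step, so it competes in the supremum
        defining the dilation norm, and its dilate has norm \<phi>(t a) / \<phi>(a).\<close>
      have "N (step (1 / \<phi> a) a) = 1"
        using \<phi>(2)[OF a] a by (simp add: N_step)
      then have "N (dilate (1 / t) (step (1 / \<phi> a) a)) \<le> dilation_norm N t"
        unfolding dilation_norm_def by (intro SUP_upper) (auto simp: step_measurable)
      then show ?thesis
        using \<phi>(2)[OF a] a t by (simp add: dilate_step N_step)
    qed
    have "dilation_norm N t < \<infinity>"
      using upper[of 1] t by (auto intro: le_less_trans)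
    then obtain h where h: "0 \<le> h" "dilation_norm N t = ennreal h"
      by (cases "dilation_norm N t") auto
    have "t powr \<alpha> \<le> h"
    proof (rule powr_le_dilation_factor[where \<phi> = \<phi>])
      show "\<phi> (t * a) \<le> h * \<phi> a" if "0 < a" for a
        using ratio[OF that] \<phi>(2)[OF that] h by (simp add: pos_divide_le_eq)
      show "\<exists>C>0. \<forall>s>0. \<forall>a>0. \<phi> (s * a) \<le> C * s powr \<alpha> * exp (\<epsilon> * \<bar>ln s\<bar>) * \<phi> a"
        if e: "0 < \<epsilon>" for \<epsilon>
      proof -
        obtain C where C: "0 < C" "\<And>t a. 0 < t \<Longrightarrow>
          fundamental (t * a) \<le> ennreal (C * t powr \<alpha> * exp (\<epsilon> * \<bar>ln t\<bar>)) * fundamental a"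
          using fundamental_dilate_le[OF e] by blast
        have "\<phi> (s * a) \<le> C * s powr \<alpha> * exp (\<epsilon> * \<bar>ln s\<bar>) * \<phi> a" if "0 < s" "0 < a" for s a
          using C(2)[OF that(1), of a] that \<phi>[of a] \<phi>[of "s * a"] C(1)
          by (simp flip: ennreal_mult)
        with C(1) show ?thesis by blast
      qed
    qed (use t \<phi> in auto)
    then show ?thesis using h by (simp add: ennreal_leI)
  qed
  show "lower_boyd N = 1 / p"
    by (subst exponent(1), rule boyd_indices_eqI(1), erule upper, erule lower)
  show "upper_boyd N = 1 / p"
    by (subst exponent(1), rule boyd_indices_eqI(2), erule upper, erule lower)
qed

text \<open>Only rearrangements are compared, so f may live on M while the indices are computed on
  the half-line: f* dominates c times the indicator of a ray, whence c times the fundamental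
  function at a is at most the norm of f.\<close>

lemma boyd_indices_nontrivial:
  assumes "nontrivial_space M {f \<in> measurable_functions M. lk (rearr M f) < \<infinity>}"
  shows "lower_boyd (\<lambda>f. lk (rearr half_line f)) = 1 / p"
    and "upper_boyd (\<lambda>f. lk (rearr half_line f)) = 1 / p"
proof -
  obtain f where f: "f \<in> measurable_functions M" "lk (rearr M f) < \<infinity>" "\<not> (AE x in M. f x = Some 0)"
    using assms by (auto simp: nontrivial_space_def)
  then obtain c a where ca: "0 < c" "0 < a" "\<And>t. ennreal c * indicator {..<a} t \<le> rearr M f t"
    using rearr_nonzero by metis
  have "ennreal c * fundamental a = lk (\<lambda>t. ennreal c * indicator {..<a} t)"
    unfolding fundamental_def by (intro lk_cmult[symmetric] antimono_indicator_lessThan ca)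
  also have "\<dots> \<le> lk (rearr M f)"
    using ca(3) by (intro lk_mono) (auto simp: antimono_def indicator_def)
  also have "\<dots> < \<infinity>" by (rule f)
  finally have "fundamental a < \<infinity>"
    using ca(1) by (auto simp: ennreal_mult_less_top)
  then show "lower_boyd (\<lambda>f. lk (rearr half_line f)) = 1 / p"
    and "upper_boyd (\<lambda>f. lk (rearr half_line f)) = 1 / p"
    using boyd_indices[OF ca(2)] by auto
qed

end

section \<open>The identity and the mean as instances\<close>

lemma dilation_equivariant_id: "dilation_equivariant (\<lambda>g. g)"
  by standard (auto intro: borel_measurable_pos_lineI borel_measurable_antimono_ennreal)

text \<open>The substitution s = t v turns the integral of g(s / t) over (0, u) into t times the
  integral of g over (0, u / t), and t / u is exactly the normalization of the mean over (0, u /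
  t).\<close>

lemma dilation_equivariant_average:
  "dilation_equivariant (\<lambda>g t. ennreal (1 / t) * (\<integral>\<^sup>+ s \<in> {0<..<t}. g s \<partial>lebesgue))"
proof
  fix g :: "real \<Rightarrow> ennreal" and t u :: real
  assume g: "antimono g"
  have meas: "g \<in> borel_measurable lebesgue"
    using borel_measurable_antimono_ennreal[OF g] by (intro measurable_completion) simp
  show "(\<lambda>t. ennreal (1 / t) * (\<integral>\<^sup>+ s \<in> {0<..<t}. g s \<partial>lebesgue)) \<in> borel_measurable pos_line"
  proof (rule borel_measurable_times_ennreal)
    \<comment> \<open>Measurability in the upper limit comes from monotonicity: a larger interval
      gives a larger integral.\<close>
    have "mono (\<lambda>t. \<integral>\<^sup>+ s \<in> {0<..<t}. g s \<partial>lebesgue)"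
      by (intro monoI nn_integral_mono) (auto simp: indicator_def)
    then show "(\<lambda>t. \<integral>\<^sup>+ s \<in> {0<..<t}. g s \<partial>lebesgue) \<in> borel_measurable pos_line"
      by (intro borel_measurable_pos_lineI borel_measurable_mono_ennreal)
    show "(\<lambda>t. ennreal (1 / t)) \<in> borel_measurable pos_line"
      by (intro borel_measurable_pos_lineI) measurable
  qed
  show "ennreal (1 / u) * (\<integral>\<^sup>+ s \<in> {0<..<u}. (ennreal c * g s) \<partial>lebesgue)
      = ennreal c * (ennreal (1 / u) * (\<integral>\<^sup>+ s \<in> {0<..<u}. g s \<partial>lebesgue))" for c
  proof -
    have "(\<integral>\<^sup>+ s \<in> {0<..<u}. (ennreal c * g s) \<partial>lebesgue)
        = ennreal c * (\<integral>\<^sup>+ s \<in> {0<..<u}. g s \<partial>lebesgue)"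
      unfolding mult.assoc using meas by (intro nn_integral_cmult borel_measurable_times_ennreal borel_measurable_indicator) auto
    then show ?thesis by (simp add: mult.left_commute)
  qed
  assume t: "0 < t" and u: "0 < u"
  have "antimono (\<lambda>v. g (v / t))"
    using t by (intro antimonoI antimonoD[OF g] divide_right_mono) auto
  then have "(\<lambda>v. g (v / t)) \<in> borel_measurable lebesgue"
    using borel_measurable_antimono_ennreal by (intro measurable_completion) simp
  then have "(\<integral>\<^sup>+ s \<in> {0<..<u}. g (s / t) \<partial>lebesgue)
      = ennreal \<bar>t\<bar> * (\<integral>\<^sup>+ s. g ((0 + t * s) / t) * indicator {0<..<u} (0 + t * s) \<partial>lebesgue)"
    using t by (intro nn_integral_real_affine_lebesgue borel_measurable_times_ennreal
        borel_measurable_indicator) auto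
  also have "(\<integral>\<^sup>+ s. g ((0 + t * s) / t) * indicator {0<..<u} (0 + t * s) \<partial>lebesgue)
      = (\<integral>\<^sup>+ s \<in> {0<..<u / t}. g s \<partial>lebesgue)"
    using t by (intro nn_integral_cong) (auto simp: indicator_def zero_less_mult_iff field_simps)
  finally have "ennreal (1 / u) * (\<integral>\<^sup>+ s \<in> {0<..<u}. g (s / t) \<partial>lebesgue)
      = (ennreal (1 / u) * ennreal t) * (\<integral>\<^sup>+ s \<in> {0<..<u / t}. g s \<partial>lebesgue)"
    using t by (simp add: mult.assoc)
  also have "ennreal (1 / u) * ennreal t = ennreal (1 / (u / t))"
    using t u by (simp flip: ennreal_mult)
  finally show "ennreal (1 / u) * (\<integral>\<^sup>+ s \<in> {0<..<u}. g (s / t) \<partial>lebesgue)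
      = ennreal (1 / (u / t)) * (\<integral>\<^sup>+ s \<in> {0<..<u / t}. g s \<partial>lebesgue)" .
next
  fix f g :: "real \<Rightarrow> ennreal" and u :: real
  assume "\<And>v. f v \<le> g v"
  then show "ennreal (1 / u) * (\<integral>\<^sup>+ s \<in> {0<..<u}. f s \<partial>lebesgue)
      \<le> ennreal (1 / u) * (\<integral>\<^sup>+ s \<in> {0<..<u}. g s \<partial>lebesgue)"
    by (intro mult_left_mono nn_integral_mono mult_right_mono) auto
next
  fix u a :: real
  assume u: "0 < u" "u < a"
  \<comment> \<open>As u < a, the indicator is 1 on all of (0, u), so its mean there is 1.\<close>
  have "(\<integral>\<^sup>+ s \<in> {0<..<u}. indicator {..<a} s \<partial>lebesgue) = (\<integral>\<^sup>+ s. indicator {0<..<u} s \<partial>lebesgue)"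
    using u by (intro nn_integral_cong) (auto simp: indicator_def)
  also have "\<dots> = ennreal u" using u by simp
  finally show "0 < ennreal (1 / u) * (\<integral>\<^sup>+ s \<in> {0<..<u}. indicator {..<a} s \<partial>lebesgue)"
    using u by (simp flip: ennreal_mult)
qed

theorem theorem3p15:
  fixes M :: "'a measure" and p q :: ereal and b :: "real \<Rightarrow> real"
  assumes "sigma_finite_measure M" and "non_atomic M" and "emeasure M (space M) = \<infinity>"
    and "0 < p" and "0 < q" and "slowly_varying b"
  shows "(nontrivial_space M (LK_space M p q b) \<longrightarrow>
            lower_boyd (LK_norm half_line p q b) = 1 / p \<and>
            upper_boyd (LK_norm half_line p q b) = 1 / p) \<and>
         (nontrivial_space M (LK_max_space M p q b) \<longrightarrow>
            lower_boyd (LK_max_norm half_line p q b) = 1 / p \<and>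
            upper_boyd (LK_max_norm half_line p q b) = 1 / p)"
proof -
  interpret I: lorentz_karamata "\<lambda>g. g" p q b
    using assms dilation_equivariant_id by (intro lorentz_karamata.intro lorentz_karamata_axioms.intro)
  interpret A: lorentz_karamata
    "\<lambda>g t. ennreal (1 / t) * (\<integral>\<^sup>+ s \<in> {0<..<t}. g s \<partial>lebesgue)" p q b
    using assms dilation_equivariant_average by (intro lorentz_karamata.intro lorentz_karamata_axioms.intro)
  \<comment> \<open>Both functionals see f only through \<open>rearr\<close>, so unfolding
    identifies them with \<open>lk\<close> for the two choices of T.\<close>
  have "LK_space M p q b = {f \<in> measurable_functions M. I.lk (rearr M f) < \<infinity>}"
    and "LK_norm half_line p q b = (\<lambda>f. I.lk (rearr half_line f))"
    by (auto simp: LK_space_def LK_norm_def I.lk_def)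
  moreover have "LK_max_space M p q b = {f \<in> measurable_functions M. A.lk (rearr M f) < \<infinity>}"
    and "LK_max_norm half_line p q b = (\<lambda>f. A.lk (rearr half_line f))"
    by (auto simp: LK_max_space_def LK_max_norm_def A.lk_def max_rearr_def)
  ultimately show ?thesis
    using I.boyd_indices_nontrivial[of M] A.boyd_indices_nontrivial[of M] by simp
qed

end
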